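(* Let $q$ be a prime power and let $f\in\mathcal{LP}_q$. Then $f$ cannot be constructed from a polynomial with separate variables by applications of the products $(f',g,h)\mapsto f'[g,h]$ and $(g,f')\mapsto gf'$ (with $f'\in\mathcal{LP}_q$ and $g,h\in\mathcal{P}_q$) if and only if $f$ is non-isolinear.
   Context: $\mathbb{F}_q$ is the finite field with $q$ elements. $\mathcal{P}_q$ is the set of polynomials in $\mathbb{F}_q[x]$ of degree less than $q$ that act as permutations of $\mathbb{F}_q$. $\mathcal{LP}_q$ is the set of polynomials $f\in\mathbb{F}_q[x,y]$ of degree less than $q$ in each variable such that, for every $a\in\mathbb{F}_q$, both $f(x,a)$ and $f(a,x)$ act as permutations of $\mathbb{F}_q$. For $f\in\mathcal{LP}_q$ and $g,h\in\mathcal{P}_q$ put $f[g,h]:=f(g(x),h(y))\in\mathcal{LP}_q$ and $gf:=g(f(x,y))\in\mathcal{LP}_q$, the compositions being taken modulo $x^q-x$ and $y^q-y$. A polynomial with separate variables is a polynomial $h_1(x)+h_2(y)\in\mathcal{LP}_q$ with $h_1,h_2\in\mathcal{P}_q$. A polynomial $f\in\mathcal{LP}_q$ is isotopic to $g\in\mathcal{LP}_q$ if $g[h_1,h_2]=h_3f$ for some $h_1,h_2,h_3\in\mathcal{P}_q$ (this is an equivalence relation). A polynomial in $\mathcal{LP}_q$ is isolinear if it is isotopic to $x+y$, and non-isolinear otherwise. *)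

theory Defs
  imports "HOL-Computational_Algebra.Polynomial" "HOL-Library.Cardinality"
begin

text \<open>
  The field with \<open>q\<close> elements is a type \<open>'a :: {field, finite}\<close> with \<open>q = CARD('a)\<close>.
  A bivariate polynomial has type \<open>'a poly poly\<close>: it is a polynomial in \<open>y\<close>
  whose coefficients are polynomials in \<open>x\<close>.
\<close>

definition acts_as_perm :: "'a::{field,finite} poly \<Rightarrow> bool" where
  "acts_as_perm g \<longleftrightarrow> bij (poly g)"

definition PP :: "'a::{field,finite} poly set" where
  "PP = {g. degree g < CARD('a) \<and> acts_as_perm g}"

text \<open>\<open>f(x, a)\<close> and \<open>f(a, y)\<close>.\<close>

definition subst_y :: "'a::comm_semiring_0 \<Rightarrow> 'a poly poly \<Rightarrow> 'a poly" where
  "subst_y a f = poly f [:a:]"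

definition subst_x :: "'a::comm_semiring_0 \<Rightarrow> 'a poly poly \<Rightarrow> 'a poly" where
  "subst_x a f = map_poly (\<lambda>c. poly c a) f"

definition LP :: "'a::{field,finite} poly poly set" where
  "LP = {f. degree f < CARD('a) \<and> (\<forall>i. degree (coeff f i) < CARD('a)) \<and>
            (\<forall>a. acts_as_perm (subst_y a f) \<and> acts_as_perm (subst_x a f))}"

text \<open>The univariate polynomial \<open>g\<close> as a bivariate one: \<open>g(x)\<close> and \<open>g(y)\<close>.\<close>

definition in_x :: "'a::zero poly \<Rightarrow> 'a poly poly" where
  "in_x g = [:g:]"

definition in_y :: "'a::zero poly \<Rightarrow> 'a poly poly" where
  "in_y g = map_poly (\<lambda>c. [:c:]) g"

text \<open>
  Reduction modulo \<open>y ^ q - y\<close> and then, coefficientwise, modulo \<open>x ^ q - x\<close>.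
  Since \<open>y ^ q - y\<close> is monic, pseudo-division by it is ordinary division with remainder,
  also over the coefficient ring \<open>'a poly\<close>, which is not a field.
\<close>

definition reduce :: "'a::{field,finite} poly poly \<Rightarrow> 'a poly poly" where
  "reduce f =
     map_poly (\<lambda>c. c mod (monom 1 CARD('a) - monom 1 1))
       (pseudo_mod f (monom 1 CARD('a) - monom 1 1))"

text \<open>\<open>f[g, h] = f(g(x), h(y))\<close> and \<open>gf = g(f(x, y))\<close>, reduced.\<close>

definition prod_inner ::
    "'a::{field,finite} poly poly \<Rightarrow> 'a poly \<Rightarrow> 'a poly \<Rightarrow> 'a poly poly" where
  "prod_inner f g h = reduce (map_poly (\<lambda>c. c \<circ>\<^sub>p g) f \<circ>\<^sub>p in_y h)"

definition prod_outer :: "'a::{field,finite} poly \<Rightarrow> 'a poly poly \<Rightarrow> 'a poly poly" where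
  "prod_outer g f = reduce (in_y g \<circ>\<^sub>p f)"

definition separate_variables :: "'a::{field,finite} poly poly \<Rightarrow> bool" where
  "separate_variables f \<longleftrightarrow>
     f \<in> LP \<and> (\<exists>h1 \<in> PP. \<exists>h2 \<in> PP. f = in_x h1 + in_y h2)"

definition isotopic :: "'a::{field,finite} poly poly \<Rightarrow> 'a poly poly \<Rightarrow> bool" where
  "isotopic f g \<longleftrightarrow> f \<in> LP \<and> g \<in> LP \<and>
     (\<exists>h1 \<in> PP. \<exists>h2 \<in> PP. \<exists>h3 \<in> PP. prod_inner g h1 h2 = prod_outer h3 f)"

definition isolinear :: "'a::{field,finite} poly poly \<Rightarrow> bool" where
  "isolinear f \<longleftrightarrow> isotopic f (in_x [:0, 1:] + in_y [:0, 1:])"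

definition non_isolinear :: "'a::{field,finite} poly poly \<Rightarrow> bool" where
  "non_isolinear f \<longleftrightarrow> f \<in> LP \<and> \<not> isolinear f"

inductive constructible_from :: "'a::{field,finite} poly poly \<Rightarrow> 'a poly poly \<Rightarrow> bool"
  for s where
  start: "constructible_from s s"
| inner: "constructible_from s f \<Longrightarrow> f \<in> LP \<Longrightarrow> g \<in> PP \<Longrightarrow> h \<in> PP \<Longrightarrow>
          constructible_from s (prod_inner f g h)"
| outer: "constructible_from s f \<Longrightarrow> f \<in> LP \<Longrightarrow> g \<in> PP \<Longrightarrow>
          constructible_from s (prod_outer g f)"

end

theory Submission
  imports Defs
begin

text \<open>
  A reduced polynomial is determined by the function it induces on pairs of field elements, and
  by interpolation every permutation of the field is induced by an element of \<open>PP\<close>. Hence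
  \<open>f\<close> is isolinear iff it induces a function \<open>(a, b) \<mapsto> h3 (h1 a + h2 b)\<close> with permutations
  \<open>h1\<close>, \<open>h2\<close>, \<open>h3\<close>. Functions of this form are closed under both products and include the
  separate-variable ones; conversely, such an \<open>f\<close> is the outer product of \<open>h3\<close> with
  \<open>h1(x) + h2(y)\<close>.
\<close>

section \<open>Evaluation of bivariate polynomials\<close>

definition eval2 :: "'a::comm_semiring_0 poly poly \<Rightarrow> 'a \<Rightarrow> 'a \<Rightarrow> 'a" where
  "eval2 f a b = poly (poly f [:b:]) a"

lemma eval2_0 [simp]: "eval2 0 a b = 0"
  by (simp add: eval2_def)

lemma eval2_pCons: "eval2 (pCons c f) a b = poly c a + b * eval2 f a b"
  by (simp add: eval2_def)

lemma eval2_add: "eval2 (f + g) a b = eval2 f a b + eval2 g a b"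
  by (simp add: eval2_def)

text \<open>The points \<open>a\<close> and \<open>a'\<close> may differ, so that this covers both
  coefficientwise reduction (\<open>a' = a\<close>) and the substitution of g(x) for x
  (\<open>a' = poly g a\<close>).\<close>

lemma eval2_map_poly:
  assumes "\<And>c. poly (F c) a = poly c a'" "F 0 = 0"
  shows "eval2 (map_poly F f) a b = eval2 f a' b"
  by (induction f) (auto simp: map_poly_pCons eval2_pCons assms)

lemma poly_subst_y: "poly (subst_y b f) a = eval2 f a b"
  by (simp add: subst_y_def eval2_def)

lemma poly_subst_x: "poly (subst_x a f) b = eval2 f a b"
  by (induction f) (auto simp: subst_x_def map_poly_pCons eval2_pCons)

lemma eval2_in_x: "eval2 (in_x g) a b = poly g a"
  by (simp add: in_x_def eval2_def)

lemma poly_in_y: "poly (poly (in_y g) p) a = poly g (poly p a)"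
  by (induction g) (auto simp: in_y_def map_poly_pCons)

lemma eval2_in_y: "eval2 (in_y g) a b = poly g b"
  by (simp add: eval2_def poly_in_y)

lemma eval2_pcompose: "eval2 (f \<circ>\<^sub>p g) a b = eval2 f a (eval2 g a b)"
  by (induction f) (auto simp: pcompose_pCons eval2_pCons eval2_def)

lemma degree_map_poly_le:
  assumes "F 0 = 0"
  shows "degree (map_poly F f) \<le> degree f"
  using assms by (intro degree_le) (simp add: coeff_map_poly coeff_eq_0)

lemma one_less_CARD: "1 < CARD('a::{field,finite})"
proof -
  have "card {0, 1 :: 'a} \<le> CARD('a)"
    by (rule card_mono) auto
  then show ?thesis by simp
qed

text \<open>Multiplication by a nonzero \<open>x\<close> permutes the nonzero elements; comparing
  their product before and after gives x^(q-1) = 1.\<close>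

lemma finite_field_power_CARD:
  fixes x :: "'a::{field,finite}"
  shows "x ^ CARD('a) = x"
proof (cases "x = 0")
  case False
  let ?P = "\<Prod>y\<in>-{0 :: 'a}. y"
  have "bij_betw ((*) x) (-{0}) (-{0})"
    by (rule bij_betw_byWitness[of _ "\<lambda>y. y / x"]) (use False in auto)
  then have "?P = (\<Prod>y\<in>-{0}. x * y)"
    by (rule prod.reindex_bij_betw[symmetric])
  also have "\<dots> = x ^ (CARD('a) - 1) * ?P"
    by (simp add: prod.distrib card_Diff_singleton Compl_eq_Diff_UNIV)
  \<comment> \<open>\<open>?P\<close> is a product of nonzero elements and cancels.\<close>
  finally have "x ^ (CARD('a) - 1) = 1"
    by simp
  then show ?thesis
    using power_minus_mult[of "CARD('a)" x] one_less_CARD[where 'a='a] by simp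
qed (use one_less_CARD[where 'a='a] in simp)

section \<open>Reduced polynomials and reduction\<close>

definition reduced :: "'a::{field,finite} poly poly \<Rightarrow> bool" where
  "reduced f \<longleftrightarrow> degree f < CARD('a) \<and> (\<forall>i. degree (coeff f i) < CARD('a))"

text \<open>A univariate polynomial of degree below q is determined by its q values. This is used
  twice: in y for each fixed x = a, then in x for each coefficient.\<close>

lemma reduced_eqI:
  fixes f g :: "'a::{field,finite} poly poly"
  assumes "reduced f" "reduced g" and eq: "\<And>a b. eval2 f a b = eval2 g a b"
  shows "f = g"
proof -
  have "subst_x a f = subst_x a g" for a
  proof (rule poly_eqI_degree[of UNIV])
    show "poly (subst_x a f) b = poly (subst_x a g) b" for b
      by (simp add: poly_subst_x eq)
    show "degree (subst_x a f) < CARD('a)" "degree (subst_x a g) < CARD('a)"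
      using assms(1,2) degree_map_poly_le[of "\<lambda>c. poly c a", THEN le_less_trans]
      by (auto simp: subst_x_def reduced_def)
  qed
  then have "poly (coeff f i) a = poly (coeff g i) a" for i a
    by (metis coeff_map_poly poly_0 subst_x_def)
  then have "coeff f i = coeff g i" for i
    using assms(1,2) by (intro poly_eqI_degree[of UNIV]) (auto simp: reduced_def)
  then show ?thesis by (rule poly_eqI)
qed

text \<open>Stated over a commutative ring so as to serve both for x^q - x over the field and for
  y^q - y over the polynomials in x.\<close>

lemma degree_monom_diff:
  assumes "1 < n"
  shows "degree (monom 1 n - monom 1 1 :: 'a::comm_ring_1 poly) = n"
    and "lead_coeff (monom 1 n - monom 1 1 :: 'a poly) = 1"
proof -
  have "degree (monom 1 n + - monom 1 1 :: 'a poly) = degree (monom 1 n :: 'a poly)"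
    using assms by (intro degree_add_eq_left) (simp add: degree_monom_eq)
  then show deg: "degree (monom 1 n - monom 1 1 :: 'a poly) = n"
    by (simp add: degree_monom_eq)
  show "lead_coeff (monom 1 n - monom 1 1 :: 'a poly) = 1"
    unfolding deg using assms by simp
qed

text \<open>Reduction only subtracts multiples of y^q - y and x^q - x, which vanish at every field
  element, so values survive.\<close>

lemma
  fixes f :: "'a::{field,finite} poly poly"
  shows reduced_reduce: "reduced (reduce f)"
    and eval2_reduce: "eval2 (reduce f) a b = eval2 f a b"
proof -
  let ?m = "monom 1 CARD('a) - monom 1 1 :: 'a poly"
  let ?M = "monom 1 CARD('a) - monom 1 1 :: 'a poly poly"
  note m = degree_monom_diff[OF one_less_CARD[where 'a='a], where 'a='a]
  note M = degree_monom_diff[OF one_less_CARD[where 'a='a], where 'a="'a poly"]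
  have M0: "?M \<noteq> 0" "?m \<noteq> 0" using m(1) M(1) by (metis degree_0 one_less_CARD not_one_less_zero)+
  obtain q where q: "pseudo_divmod f ?M = (q, pseudo_mod f ?M)"
    by (metis pseudo_mod_def prod.collapse)
  \<comment> \<open>Pseudo-division scales \<open>f\<close> by a power of the leading coefficient of
    \<open>?M\<close>, which is 1.\<close>
  have eq: "f = ?M * q + pseudo_mod f ?M"
    using pseudo_divmod(1)[OF M0(1) q] unfolding M(2) by (simp only: power_one smult_1_left)
  have deg: "degree (pseudo_mod f ?M) < CARD('a)"
    using pseudo_divmod(2)[OF M0(1) q] M(1) by auto
  have "degree (c mod ?m) < CARD('a)" for c
    using degree_mod_less[OF M0(2), of c] m(1) by auto
  then show "reduced (reduce f)"
    using le_less_trans[OF degree_map_poly_le deg, of "\<lambda>c. c mod ?m"]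
    by (auto simp: reduced_def reduce_def coeff_map_poly)
  have m_root: "poly ?m a = 0" for a
    by (simp add: poly_monom finite_field_power_CARD)
  have "poly (c mod ?m) a = poly c a" for c
    using arg_cong[OF div_mult_mod_eq[of c ?m], of "\<lambda>p. poly p a"] m_root by simp
  then have "eval2 (reduce f) a b = eval2 (pseudo_mod f ?M) a b"
    by (simp add: reduce_def eval2_map_poly)
  also have "\<dots> = eval2 (?M * q + pseudo_mod f ?M) a b"
    by (simp add: eval2_def poly_monom finite_field_power_CARD)
  finally show "eval2 (reduce f) a b = eval2 f a b"
    using eq by simp
qed

text \<open>With \<open>reduced_eqI\<close>, these facts turn identities between products into
  identities between functions.\<close>

lemma reduced_prod_inner: "reduced (prod_inner f g h)"
  and eval2_prod_inner: "eval2 (prod_inner f g h) a b = eval2 f (poly g a) (poly h b)"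
  unfolding prod_inner_def
  by (simp_all add: reduced_reduce eval2_reduce eval2_pcompose eval2_in_y
        eval2_map_poly[where a' = "poly g a"] poly_pcompose)

lemma reduced_prod_outer: "reduced (prod_outer g f)"
  and eval2_prod_outer: "eval2 (prod_outer g f) a b = poly g (eval2 f a b)"
  unfolding prod_outer_def
  by (simp_all add: reduced_reduce eval2_reduce eval2_pcompose eval2_in_y)

lemma finite_field_interpolation:
  fixes F :: "'a::{field,finite} \<Rightarrow> 'a"
  obtains p where "degree p < CARD('a)" "poly p = F"
proof
  \<comment> \<open>Lagrange interpolation: \<open>L a\<close> vanishes exactly off
    \<open>a\<close>, and \<open>p\<close> normalises it by its value at \<open>a\<close>.\<close>
  define L where "L a = (\<Prod>b\<in>-{a}. [:-b, 1:])" for a :: 'a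
  define p where "p = (\<Sum>a\<in>UNIV. smult (F a / poly (L a) a) (L a))"
  have "degree (L a) \<le> CARD('a) - 1" for a
  proof -
    have "degree (L a) \<le> (\<Sum>b\<in>-{a}. degree [:-b, 1:])"
      unfolding L_def using degree_prod_sum_le[of "-{a}" "\<lambda>b. [:-b, 1:]"] by (simp add: o_def)
    then show ?thesis by (simp add: card_Diff_singleton Compl_eq_Diff_UNIV)
  qed
  then have "degree p \<le> CARD('a) - 1"
    unfolding p_def by (intro degree_sum_le) (auto intro: order_trans[OF degree_smult_le])
  then show "degree p < CARD('a)"
    using one_less_CARD[where 'a='a] by linarith
  have L: "poly (L a) c = 0 \<longleftrightarrow> a \<noteq> c" for a c
    by (auto simp: L_def poly_prod)
  have "poly p c = F c" for c
  proof -
    have "poly p c = (\<Sum>a\<in>UNIV. if a = c then F c else 0)"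
      unfolding p_def poly_sum using L by (intro sum.cong) auto
    then show ?thesis by simp
  qed
  then show "poly p = F" by blast
qed

section \<open>Permutation polynomials and the functional form of isolinearity\<close>

lemma PP_iff: "g \<in> PP \<longleftrightarrow> degree g < CARD('a) \<and> bij (poly g)" for g :: "'a::{field,finite} poly"
  by (simp add: PP_def acts_as_perm_def)

lemma LP_iff:
  "f \<in> LP \<longleftrightarrow> reduced f \<and> (\<forall>b. bij (\<lambda>a. eval2 f a b)) \<and> (\<forall>a. bij (\<lambda>b. eval2 f a b))"
  by (auto simp: LP_def reduced_def acts_as_perm_def poly_subst_x[abs_def] poly_subst_y[abs_def])

text \<open>Lets inverses and composites, formed as functions, be represented in \<open>PP\<close>
  again.\<close>

lemma PP_interpolation:
  assumes "bij F"
  obtains p where "p \<in> PP" "poly p = F"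
  using finite_field_interpolation[of F] assms by (metis PP_iff)

lemma PP_inverse:
  assumes "g \<in> PP"
  obtains g' where "g' \<in> PP" "\<And>a. poly g' (poly g a) = a"
proof -
  from assms have g: "bij (poly g)" by (simp add: PP_iff)
  then obtain g' where "g' \<in> PP" "poly g' = inv (poly g)"
    using PP_interpolation[OF bij_imp_bij_inv] by metis
  with g show ?thesis
    by (intro that[of g']) (simp_all add: bij_is_inj)
qed

lemma PP_comp:
  assumes "g \<in> PP" "h \<in> PP"
  obtains k where "k \<in> PP" "\<And>a. poly k a = poly g (poly h a)"
  using PP_interpolation[OF bij_comp[of "poly h" "poly g"]] assms
  by (metis PP_iff comp_apply)

text \<open>Fixing one variable leaves a permutation followed by a translation.\<close>

lemma separate_in_LP:
  assumes "h1 \<in> PP" "h2 \<in> PP"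
  shows "in_x h1 + in_y h2 \<in> LP"
proof -
  have "reduced (in_x h1 + in_y h2)"
    using assms one_less_CARD[where 'a='a] degree_map_poly_le[of "\<lambda>c. [:c:]" h2]
    by (auto simp: reduced_def in_x_def in_y_def PP_iff coeff_map_poly coeff_pCons
        split: nat.splits intro!: degree_add_less le_less_trans[OF degree_map_poly_le])
  moreover have "bij (\<lambda>a. poly h1 a + c)" "bij (\<lambda>b. c + poly h2 b)" for c
    using assms bij_comp[of "poly h1" "(+) c"] bij_comp[of "poly h2" "(+) c"]
    by (auto simp: PP_iff o_def add.commute)
  ultimately show ?thesis
    by (simp add: LP_iff eval2_add eval2_in_x eval2_in_y)
qed

text \<open>Isotopy to x + y says h1(a) + h2(b) = h3(f(a, b)); the inverse of \<open>h3\<close>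
  moves it to the other side, giving a form suited to induction over the products.\<close>

lemma isolinear_iff:
  assumes "f \<in> LP"
  shows "isolinear f \<longleftrightarrow>
    (\<exists>h1\<in>PP. \<exists>h2\<in>PP. \<exists>h3\<in>PP. \<forall>a b. eval2 f a b = poly h3 (poly h1 a + poly h2 b))"
    (is "_ \<longleftrightarrow> ?R")
proof -
  have X: "[:0, 1:] \<in> (PP :: 'a poly set)"
    using one_less_CARD[where 'a='a] by (simp add: PP_iff bij_def inj_on_def surj_def)
  have eq_iff: "prod_inner (in_x [:0, 1:] + in_y [:0, 1:]) h1 h2 = prod_outer h3 f \<longleftrightarrow>
      (\<forall>a b. poly h1 a + poly h2 b = poly h3 (eval2 f a b))" (is "?p = ?q \<longleftrightarrow> _") for h1 h2 h3
  proof -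
    have "?p = ?q \<longleftrightarrow> (\<forall>a b. eval2 ?p a b = eval2 ?q a b)"
      by (auto intro: reduced_eqI[OF reduced_prod_inner reduced_prod_outer])
    then show ?thesis
      by (simp add: eval2_prod_inner eval2_prod_outer eval2_add eval2_in_x eval2_in_y)
  qed
  have "isolinear f \<longleftrightarrow>
      (\<exists>h1\<in>PP. \<exists>h2\<in>PP. \<exists>h3\<in>PP. \<forall>a b. poly h1 a + poly h2 b = poly h3 (eval2 f a b))"
    using assms separate_in_LP[OF X X] by (simp add: isolinear_def isotopic_def eq_iff)
  also have "\<dots> \<longleftrightarrow> ?R"
  proof -
    have "(\<exists>h3\<in>PP. \<forall>a b. poly h1 a + poly h2 b = poly h3 (eval2 f a b)) \<longleftrightarrow>
        (\<exists>h3\<in>PP. \<forall>a b. eval2 f a b = poly h3 (poly h1 a + poly h2 b))" (is "?A \<longleftrightarrow> ?B") for h1 h2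
    proof
      assume ?A
      then obtain h3 where h3: "h3 \<in> PP" "\<And>a b. poly h1 a + poly h2 b = poly h3 (eval2 f a b)"
        by auto
      obtain k where "k \<in> PP" "\<And>a. poly k (poly h3 a) = a"
        using PP_inverse[OF h3(1)] by metis
      with h3 show ?B by (intro bexI[of _ k]) simp_all
    next
      assume ?B
      then obtain h3 where h3: "h3 \<in> PP" "\<And>a b. eval2 f a b = poly h3 (poly h1 a + poly h2 b)"
        by auto
      obtain k where "k \<in> PP" "\<And>a. poly k (poly h3 a) = a"
        using PP_inverse[OF h3(1)] by metis
      with h3 show ?A by (intro bexI[of _ k]) simp_all
    qed
    then show ?thesis by simp
  qed
  finally show ?thesis .
qed

section \<open>Closure under the two products, and the converse construction\<close>

lemma separate_variables_isolinear:
  assumes "separate_variables s"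
  shows "isolinear s"
proof -
  obtain h1 h2 where s: "s \<in> LP" "h1 \<in> PP" "h2 \<in> PP" "s = in_x h1 + in_y h2"
    using assms by (auto simp: separate_variables_def)
  obtain h3 :: "'a poly" where "h3 \<in> PP" "poly h3 = id"
    using PP_interpolation[OF bij_id] .
  with s show ?thesis
    unfolding isolinear_iff[OF s(1)] by (metis eval2_add eval2_in_x eval2_in_y id_apply)
qed

lemma prod_inner_in_LP:
  assumes "f \<in> LP" "g \<in> PP" "h \<in> PP"
  shows "prod_inner f g h \<in> LP"
  using assms bij_comp[of "poly g" "\<lambda>a. eval2 f a _"] bij_comp[of "poly h" "eval2 f _"]
  by (auto simp: LP_iff PP_iff reduced_prod_inner eval2_prod_inner o_def)

lemma prod_outer_in_LP:
  assumes "f \<in> LP" "g \<in> PP"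
  shows "prod_outer g f \<in> LP"
  using assms bij_comp[of _ "poly g"]
  by (auto simp: LP_iff PP_iff reduced_prod_outer eval2_prod_outer o_def)

text \<open>In the functional form, an inner product replaces \<open>h1\<close>, \<open>h2\<close>
  by their composites with \<open>g\<close>, \<open>h\<close>, and an outer product replaces
  \<open>h3\<close> by \<open>g\<close> after \<open>h3\<close>.\<close>

lemma constructible_from_isolinear:
  assumes "constructible_from s f" "separate_variables s"
  shows "isolinear f"
  using assms
proof (induction rule: constructible_from.induct)
  case start
  then show ?case by (rule separate_variables_isolinear)
next
  case (inner f g h)
  then obtain h1 h2 h3 where h: "h1 \<in> PP" "h2 \<in> PP" "h3 \<in> PP"
    "\<And>a b. eval2 f a b = poly h3 (poly h1 a + poly h2 b)"
    using isolinear_iff by metis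
  obtain k1 k2 where "k1 \<in> PP" "\<And>a. poly k1 a = poly h1 (poly g a)"
    "k2 \<in> PP" "\<And>a. poly k2 a = poly h2 (poly h a)"
    using PP_comp inner.hyps h by metis
  with h show ?case
    unfolding isolinear_iff[OF prod_inner_in_LP[OF inner.hyps(2-4)]] eval2_prod_inner by metis
next
  case (outer f g)
  then obtain h1 h2 h3 where h: "h1 \<in> PP" "h2 \<in> PP" "h3 \<in> PP"
    "\<And>a b. eval2 f a b = poly h3 (poly h1 a + poly h2 b)"
    using isolinear_iff by metis
  obtain k where "k \<in> PP" "\<And>a. poly k a = poly g (poly h3 a)"
    using PP_comp outer.hyps h by metis
  with h show ?case
    unfolding isolinear_iff[OF prod_outer_in_LP[OF outer.hyps(2,3)]] eval2_prod_outer by metis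
qed

lemma isolinear_constructible:
  assumes "f \<in> LP" "isolinear f"
  shows "\<exists>s. separate_variables s \<and> constructible_from s f"
proof -
  obtain h1 h2 h3 where h: "h1 \<in> PP" "h2 \<in> PP" "h3 \<in> PP"
    "\<And>a b. eval2 f a b = poly h3 (poly h1 a + poly h2 b)"
    using assms isolinear_iff by metis
  let ?s = "in_x h1 + in_y h2"
  have s: "?s \<in> LP" using h by (intro separate_in_LP)
  \<comment> \<open>Both sides are reduced, so comparing values suffices.\<close>
  have "f = prod_outer h3 ?s"
    using assms(1) h(4)
    by (intro reduced_eqI reduced_prod_outer)
       (auto simp: LP_iff eval2_prod_outer eval2_add eval2_in_x eval2_in_y)
  moreover have "constructible_from ?s (prod_outer h3 ?s)"
    using s h(3) by (intro constructible_from.intros)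
  ultimately show ?thesis
    using s h by (auto simp: separate_variables_def)
qed

theorem proposition4p1:
  fixes f :: "'a::{field,finite} poly poly"
  assumes "f \<in> LP"
  shows "\<not> (\<exists>s. separate_variables s \<and> constructible_from s f) \<longleftrightarrow> non_isolinear f"
  using assms constructible_from_isolinear isolinear_constructible
  by (auto simp: non_isolinear_def)

end
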